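(* Let $k,N\in\mathbb{N}$ and let $\mathcal{F}$ be a nonempty collection of $k$-colourings of $E(K_N)$. For any $\varepsilon>0$ there exist constants $C_0,n_0>0$, depending only on $(\varepsilon,k,N)$, such that for every $n\ge n_0$ there exists a collection $\mathcal{T}_n$ of $k$-colouring templates for $K_n$ satisfying: (i) $\mathcal{T}_n$ is a container family for $\mathrm{Forb}(\mathcal{F})_n$, i.e. for every template $t$ of $K_n$ with $\langle t\rangle\subseteq \mathrm{Forb}(\mathcal{F})_n$ there exists $t'\in\mathcal{T}_n$ with $t(e)\subseteq t'(e)$ for every $e\in E(K_n)$; (ii) for each $t\in\mathcal{T}_n$ there are at most $\varepsilon\binom{n}{N}$ pairs $(\phi,c)$ with $\phi\in\binom{K_n}{K_N}$, $c\in\mathcal{F}$ and $c\in\langle t_{|\phi}\rangle$; (iii) $\log_k|\mathcal{T}_n|\le \dfrac{C_0}{n^{1/(2\binom{N}{2}-1)}}\binom{n}{2}$.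
   Context: $K_n$ is the complete graph on $[n]=\{1,\dots,n\}$, with $E(K_n)=[n]^{(2)}$. A $k$-colouring of $K_n$ is a map $c:E(K_n)\to[k]$. For $m\le n$, $\binom{K_n}{K_m}$ denotes the set of order-preserving injections $\phi:[m]\to[n]$; for a $k$-colouring $c$ of $K_n$, $c_{|\phi}$ is the $k$-colouring of $K_m$ given by $c_{|\phi}(ij)=c(\phi(i)\phi(j))$. A ($k$-colouring) template for $K_n$ is a map $t:E(K_n)\to 2^{[k]}\setminus\{\emptyset\}$; $t_{|\phi}$ is defined by $t_{|\phi}(ij)=t(\phi(i)\phi(j))$; $\langle t\rangle$ is the set of $k$-colourings $c$ with $c(e)\in t(e)$ for all $e$. For a family $\mathcal{F}$ of $k$-colourings of $K_N$, $\mathrm{Forb}(\mathcal{F})_n$ is the set of $k$-colourings $c$ of $K_n$ such that $c_{|\phi}\notin\mathcal{F}$ for all $\phi\in\binom{K_n}{K_N}$. *)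

theory Defs
  imports Complex_Main "HOL-Library.FuncSet"
begin

definition K_edges :: "nat \<Rightarrow> nat set set" where
  "K_edges n = {e. e \<subseteq> {1..n} \<and> card e = 2}"

text \<open>
  All maps below live in extensional function spaces, so that each map on its finite domain
  is represented by exactly one HOL function; in particular the sets of colourings, templates
  and injections are finite and cardinalities are the intended ones.
\<close>

definition colourings :: "nat \<Rightarrow> nat \<Rightarrow> (nat set \<Rightarrow> nat) set" where
  "colourings k n = K_edges n \<rightarrow>\<^sub>E {1..k}"

definition templates :: "nat \<Rightarrow> nat \<Rightarrow> (nat set \<Rightarrow> nat set) set" where
  "templates k n = K_edges n \<rightarrow>\<^sub>E (Pow {1..k} - {{}})"

definition order_embeddings :: "nat \<Rightarrow> nat \<Rightarrow> (nat \<Rightarrow> nat) set" where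
  "order_embeddings m n =
     {\<phi> \<in> {1..m} \<rightarrow>\<^sub>E {1..n}. inj_on \<phi> {1..m} \<and> mono_on {1..m} \<phi>}"

text \<open>
  Restriction along an injection of \<open>[m]\<close>, for colourings and templates alike: the edge
  \<open>ij\<close> is sent to the value at the edge \<open>\<phi>(i)\<phi>(j)\<close>.
\<close>

definition restr :: "nat \<Rightarrow> (nat set \<Rightarrow> 'a) \<Rightarrow> (nat \<Rightarrow> nat) \<Rightarrow> (nat set \<Rightarrow> 'a)" where
  "restr m f \<phi> = (\<lambda>e\<in>K_edges m. f (\<phi> ` e))"

definition realisations :: "nat \<Rightarrow> nat \<Rightarrow> (nat set \<Rightarrow> nat set) \<Rightarrow> (nat set \<Rightarrow> nat) set" where
  "realisations k n t = {c \<in> colourings k n. \<forall>e\<in>K_edges n. c e \<in> t e}"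

definition Forb :: "nat \<Rightarrow> nat \<Rightarrow> (nat set \<Rightarrow> nat) set \<Rightarrow> nat \<Rightarrow> (nat set \<Rightarrow> nat) set" where
  "Forb k N F n = {c \<in> colourings k n. \<forall>\<phi>\<in>order_embeddings N n. restr N c \<phi> \<notin> F}"

definition container_family ::
  "nat \<Rightarrow> nat \<Rightarrow> (nat set \<Rightarrow> nat) set \<Rightarrow> (nat set \<Rightarrow> nat set) set \<Rightarrow> bool" where
  "container_family k n P T \<longleftrightarrow>
     (\<forall>t\<in>templates k n. realisations k n t \<subseteq> P \<longrightarrow>
        (\<exists>t'\<in>T. \<forall>e\<in>K_edges n. t e \<subseteq> t' e))"

end

theory Submission
  imports Defs
begin

text \<open>
  A template \<open>t\<close> is a set of pairs \<open>(e, a)\<close> with \<open>a \<in> t e\<close>. It has all its realisations in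
  \<open>Forb\<close> iff this set is independent in the hypergraph whose edges are the coloured copies
  \<open>(\<phi>, c)\<close> with \<open>c \<in> F\<close>. This hypergraph is \<open>r\<close>-uniform with \<open>r = N choose 2\<close>, lives on about
  \<open>n\<^sup>2\<close> vertices, has degrees of order \<open>n ^ (N - 2)\<close>, and its codegrees are smaller by a factor \<open>n\<close>,
  because two distinct edges of \<open>K\<^sub>n\<close> span at least three vertices.

  For such hypergraphs a container algorithm in the style of Kleitman and Winston lowers the
  uniformity one step at a time; only the codegree of pairs is needed. Each run removes a constant
  proportion of the vertices as long as many edges are left, at the cost of \<open>q\<close> choices of
  vertices per level, where \<open>q\<close> is about \<open>n powr (2 - 1 / r)\<close>. Boundedly many runs leave few edges, and
  since \<open>1 / r > 1 / (2 * r - 1)\<close> for \<open>r > 1\<close>, the factor \<open>log n\<close> in the count is absorbed (for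
  \<open>r = 1\<close> no choices are made).
\<close>

subsection \<open>Covering families\<close>

text \<open>Edges are indexed by \<open>J\<close> through \<open>g\<close> and counted with
  multiplicity: shortened edges may coincide, and an index keeps its identity when \<open>g\<close>
  is replaced by a shortened \<open>h\<close>.\<close>

definition hdeg :: "('j \<Rightarrow> 'a set) \<Rightarrow> 'j set \<Rightarrow> 'a \<Rightarrow> nat" where
  "hdeg g J x = card {j \<in> J. x \<in> g j}"

definition indep :: "'a set \<Rightarrow> ('j \<Rightarrow> 'a set) \<Rightarrow> 'j set \<Rightarrow> 'a set set" where
  "indep V g J = {I. I \<subseteq> V \<and> (\<forall>j\<in>J. \<not> g j \<subseteq> I)}"

text \<open>The container family is hidden behind a bound \<open>b\<close> on its size, so that
  counting becomes adding \<open>b\<close> over the branches of a decision tree and multiplying it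
  over successive rounds.\<close>

definition coverable :: "('a set \<Rightarrow> bool) \<Rightarrow> nat \<Rightarrow> 'a set set \<Rightarrow> bool" where
  "coverable good b \<I> \<longleftrightarrow>
     (\<exists>\<C>. finite \<C> \<and> card \<C> \<le> b \<and> (\<forall>C\<in>\<C>. good C) \<and> (\<forall>I\<in>\<I>. \<exists>C\<in>\<C>. I \<subseteq> C))"

lemma coverableI:
  assumes "finite \<C>" "card \<C> \<le> b" "\<And>C. C \<in> \<C> \<Longrightarrow> good C"
    "\<And>I. I \<in> \<I> \<Longrightarrow> \<exists>C\<in>\<C>. I \<subseteq> C"
  shows "coverable good b \<I>"
  unfolding coverable_def by (rule exI[of _ \<C>]) (simp add: assms)

lemma coverableE:
  assumes "coverable good b \<I>"
  obtains \<C> where "finite \<C>" "card \<C> \<le> b" "\<And>C. C \<in> \<C> \<Longrightarrow> good C"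
    "\<And>I. I \<in> \<I> \<Longrightarrow> \<exists>C\<in>\<C>. I \<subseteq> C"
proof -
  from assms obtain \<C> where "finite \<C> \<and> card \<C> \<le> b \<and> (\<forall>C\<in>\<C>. good C) \<and> (\<forall>I\<in>\<I>. \<exists>C\<in>\<C>. I \<subseteq> C)"
    unfolding coverable_def ..
  then show thesis by (intro that[of \<C>]) simp_all
qed

lemma coverable_mono:
  assumes "coverable good b \<I>" "\<I>' \<subseteq> \<I>" "b \<le> b'" "\<And>C. good C \<Longrightarrow> good' C"
  shows "coverable good' b' \<I>'"
proof -
  obtain \<C> where "finite \<C>" "card \<C> \<le> b" "\<And>C. C \<in> \<C> \<Longrightarrow> good C"
    "\<And>I. I \<in> \<I> \<Longrightarrow> \<exists>C\<in>\<C>. I \<subseteq> C"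
    using coverableE[OF assms(1)] by metis
  with assms(2-4) show ?thesis by (intro coverableI[of \<C>]) auto
qed

lemma coverable_Un:
  assumes "coverable good b \<I>" "coverable good b' \<I>'"
  shows "coverable good (b + b') (\<I> \<union> \<I>')"
proof -
  obtain \<C> where \<C>: "finite \<C>" "card \<C> \<le> b" "\<And>C. C \<in> \<C> \<Longrightarrow> good C"
    "\<And>I. I \<in> \<I> \<Longrightarrow> \<exists>C\<in>\<C>. I \<subseteq> C"
    using coverableE[OF assms(1)] by metis
  obtain \<C>' where \<C>': "finite \<C>'" "card \<C>' \<le> b'" "\<And>C. C \<in> \<C>' \<Longrightarrow> good C"
    "\<And>I. I \<in> \<I>' \<Longrightarrow> \<exists>C\<in>\<C>'. I \<subseteq> C"
    using coverableE[OF assms(2)] by metis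
  show ?thesis
  proof (rule coverableI[of "\<C> \<union> \<C>'"])
    show "card (\<C> \<union> \<C>') \<le> b + b'"
      using card_Un_le[of \<C> \<C>'] \<C>(2) \<C>'(2) by linarith
    show "\<exists>C\<in>\<C> \<union> \<C>'. I \<subseteq> C" if "I \<in> \<I> \<union> \<I>'" for I
      using that \<C>(4) \<C>'(4) by blast
  qed (use \<C>(1,3) \<C>'(1,3) in auto)
qed

lemma coverable_single:
  assumes "good C" "\<And>I. I \<in> \<I> \<Longrightarrow> I \<subseteq> C" "1 \<le> b"
  shows "coverable good b \<I>"
  by (rule coverableI[of "{C}"]) (use assms in auto)

lemma coverable_trans:
  assumes "coverable good b \<I>"
    and "\<And>C. good C \<Longrightarrow> coverable good' b' (\<I> \<inter> Pow C)"
  shows "coverable good' (b * b') \<I>"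
proof -
  obtain \<C> where \<C>: "finite \<C>" "card \<C> \<le> b" "\<And>C. C \<in> \<C> \<Longrightarrow> good C"
    "\<And>I. I \<in> \<I> \<Longrightarrow> \<exists>C\<in>\<C>. I \<subseteq> C"
    using coverableE[OF assms(1)] by metis
  have "\<forall>C\<in>\<C>. \<exists>\<D>. finite \<D> \<and> card \<D> \<le> b' \<and> (\<forall>D\<in>\<D>. good' D) \<and> (\<forall>I\<in>\<I> \<inter> Pow C. \<exists>D\<in>\<D>. I \<subseteq> D)"
    using assms(2)[OF \<C>(3)] unfolding coverable_def by simp
  then obtain \<D> where \<D>: "\<forall>C\<in>\<C>. finite (\<D> C) \<and> card (\<D> C) \<le> b' \<and> (\<forall>D\<in>\<D> C. good' D) \<and>
      (\<forall>I\<in>\<I> \<inter> Pow C. \<exists>D\<in>\<D> C. I \<subseteq> D)"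
    by (elim bchoice[elim_format] exE)
  have "card (\<Union>C\<in>\<C>. \<D> C) \<le> (\<Sum>C\<in>\<C>. card (\<D> C))"
    using \<C>(1) by (rule card_UN_le)
  also have "\<dots> \<le> card \<C> * b'"
    by (rule sum_bounded_above[of \<C> "\<lambda>C. card (\<D> C)" b', simplified]) (use \<D> in blast)
  also have "\<dots> \<le> b * b'" using \<C>(2) by simp
  finally have card: "card (\<Union>C\<in>\<C>. \<D> C) \<le> b * b'" .
  show ?thesis
  proof (rule coverableI[OF _ card])
    show "\<exists>D\<in>\<Union>C\<in>\<C>. \<D> C. I \<subseteq> D" if I: "I \<in> \<I>" for I
    proof -
      obtain C where C: "C \<in> \<C>" "I \<subseteq> C" using \<C>(4)[OF I] by blast
      then have "\<exists>D\<in>\<D> C. I \<subseteq> D" using \<D> I by simp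
      then show ?thesis using C(1) by blast
    qed
  qed (use \<C>(1) \<D> in auto)
qed

subsection \<open>Containers for hypergraphs with small codegrees\<close>

lemma sum_hdeg:
  assumes "finite V" "finite J" "\<And>j. j \<in> J \<Longrightarrow> g j \<subseteq> V"
  shows "(\<Sum>x\<in>V. hdeg g J x) = (\<Sum>j\<in>J. card (g j))"
  unfolding hdeg_def
proof (rule sum_multicount_gen[OF assms(1,2)], intro ballI)
  fix j assume "j \<in> J"
  then have "{x \<in> V. x \<in> g j} = g j" using assms(3) by auto
  then show "card {x \<in> V. x \<in> g j} = card (g j)" by simp
qed

text \<open>Charge each edge of \<open>J'\<close> to a vertex of \<open>B\<close> that it meets; no
  vertex is charged more than \<open>D\<close> times.\<close>

lemma card_meeting_le:
  assumes "finite J" "finite B" "\<And>x. real (hdeg g J x) \<le> D" "J' \<subseteq> J"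
    and "\<And>j. j \<in> J' \<Longrightarrow> g j \<inter> B \<noteq> {}"
  shows "real (card J') \<le> D * card B"
proof -
  have "card J' \<le> card (\<Union>x\<in>B. {j \<in> J. x \<in> g j})"
  proof (rule card_mono)
    show "finite (\<Union>x\<in>B. {j \<in> J. x \<in> g j})" using assms(1,2) by simp
    show "J' \<subseteq> (\<Union>x\<in>B. {j \<in> J. x \<in> g j})" using assms(4,5) by blast
  qed
  also have "\<dots> \<le> (\<Sum>x\<in>B. hdeg g J x)"
    unfolding hdeg_def using assms(2) by (rule card_UN_le)
  finally have "real (card J') \<le> (\<Sum>x\<in>B. real (hdeg g J x))"
    by (metis of_nat_le_iff of_nat_sum)
  also have "\<dots> \<le> D * card B"
    using sum_bounded_above[of B "\<lambda>x. real (hdeg g J x)" D] assms(3) by (simp add: mult.commute)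
  finally show ?thesis .
qed

text \<open>This is the branching of the decision tree: once a vertex is scanned, a negative answer
  leaves \<open>t\<close> positive ones available and a positive answer leaves
  \<open>t - 1\<close>.\<close>

lemma power_add_pred_le:
  fixes a t :: nat
  assumes "a > 0" "t > 0"
  shows "a ^ t + a ^ (t - 1) \<le> (a + 1) ^ t"
proof -
  obtain u where t: "t = Suc u" using assms(2) gr0_conv_Suc by auto
  have "a ^ u \<le> (a + 1) ^ u" by (rule power_mono) auto
  then have "(a + 1) * a ^ u \<le> (a + 1) * (a + 1) ^ u" by (rule mult_le_mono2)
  then show ?thesis unfolding t by simp
qed

text \<open>
  One pass of the container algorithm. A vertex \<open>v\<close> of degree at least \<open>\<tau>\<close> among the live edges is
  either outside \<open>I\<close>, and is then discarded, or inside \<open>I\<close>, and then the live edges through \<open>v\<close>,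
  shortened by \<open>v\<close>, form part of an \<open>r\<close>-uniform hypergraph in which \<open>I\<close> is still independent.
  Following both branches of this decision tree, in which at most \<open>q\<close> positive answers are
  allowed, counts the containers without any explicit fingerprints.
\<close>

lemma scan_vertices:
  fixes V :: "'a set" and J :: "'j set" and D K \<Delta> \<tau> G :: real
  assumes fin: "finite V" "finite J"
    and edge: "\<And>j. j \<in> J \<Longrightarrow> g j \<subseteq> V \<and> card (g j) = Suc r"
    and deg: "\<And>x. real (hdeg g J x) \<le> D"
    and codeg: "\<And>x y. x \<noteq> y \<Longrightarrow> real (card {j \<in> J. x \<in> g j \<and> y \<in> g j}) \<le> K"
    and pos: "0 < D" "0 < \<Delta>" "0 < \<tau>" "0 \<le> K" "0 < X"
    and many: "\<tau> * card V + D * (q + r * (D * q) / \<Delta> + G) \<le> real (card J)"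
    and rec: "\<And>Q h. Q \<subseteq> J \<Longrightarrow> (\<And>j. j \<in> Q \<Longrightarrow> h j \<subseteq> g j \<and> card (h j) = r) \<Longrightarrow>
        (\<And>x. real (hdeg h Q x) \<le> \<Delta> + K) \<Longrightarrow> \<tau> * q \<le> real (card Q) \<Longrightarrow>
        coverable (\<lambda>C. C \<subseteq> V \<and> card C + G \<le> card V) X (indep V h Q)"
  shows "coverable (\<lambda>C. C \<subseteq> V \<and> card C + G \<le> card V) (X * (card V + 1) ^ q) (indep V g J)"
proof -
  define good where "good = (\<lambda>C. C \<subseteq> V \<and> card C + G \<le> card V)"
  define bad where "bad h Q = {x \<in> V. \<Delta> \<le> real (hdeg h Q x)}" for h :: "'j \<Rightarrow> 'a set" and Q
  \<comment> \<open>\<open>A\<close>: unscanned vertices; \<open>R\<close>: discarded ones; \<open>P\<close>: live edges; \<open>Q\<close>: edges shortened to \<open>h\<close>;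
    \<open>s\<close>: positive answers so far, \<open>t\<close> of them left. A vertex whose degree in \<open>Q\<close> reaches \<open>\<Delta>\<close>
    becomes bad and kills its live edges, so no degree in \<open>Q\<close> ever exceeds \<open>\<Delta> + K\<close>.\<close>
  have main: "coverable good (X * (card A + 1) ^ t) (indep V g P \<inter> indep V h Q \<inter> {I. I \<inter> R = {}})"
    if "A \<subseteq> V" "R \<subseteq> V" "A \<inter> R = {}" "P \<subseteq> J" "Q \<subseteq> J" "P \<inter> Q = {}"
      and PA: "\<And>j. j \<in> P \<Longrightarrow> g j \<subseteq> A"
      and hg: "\<And>j. j \<in> Q \<Longrightarrow> h j \<subseteq> g j \<and> card (h j) = r"
      and degQ: "\<And>x. real (hdeg h Q x) \<le> \<Delta> + K"
      and P_ok: "\<And>j x. j \<in> P \<Longrightarrow> x \<in> g j \<Longrightarrow> real (hdeg h Q x) < \<Delta>"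
      and Qlo: "\<tau> * s \<le> real (card Q)" and Qhi: "real (card Q) \<le> D * s"
      and st: "s + t = q"
      and cnt: "real (card J) \<le> card P + D * (card R + s + card (bad h Q))"
    for A R P Q h s t
    using that
  proof (induction "card A" arbitrary: A R P Q h s t rule: less_induct)
    case less
    note prems = less.prems
    note PA = less.prems(7) and hg = less.prems(8) and degQ = less.prems(9) and P_ok = less.prems(10)
      and Qlo = less.prems(11) and Qhi = less.prems(12) and st = less.prems(13) and cnt = less.prems(14)
    have finA: "finite A" and finR: "finite R" and finP: "finite P" and finQ: "finite Q"
      using prems(1,2,4,5) fin by (auto intro: finite_subset)
    have finbad: "finite (bad h Q)" for h Q using fin by (simp add: bad_def)
    have hV: "h j \<subseteq> V" if "j \<in> Q" for j using that hg edge prems(5) by blast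
    have degP: "real (hdeg g P x) \<le> D" for x
    proof -
      have "hdeg g P x \<le> hdeg g J x"
        unfolding hdeg_def using prems(4) fin by (intro card_mono) auto
      then show ?thesis using deg[of x] by linarith
    qed
    consider "t = 0" | "t > 0" "\<And>v. v \<in> A \<Longrightarrow> real (hdeg g P v) < \<tau>"
      | v where "t > 0" "v \<in> A" "\<tau> \<le> real (hdeg g P v)"
      by force
    then show ?case
    proof cases
      case 1
      \<comment> \<open>With no positive answers left, \<open>s = q\<close>, so \<open>Q\<close> has
        at least \<open>\<tau> * q\<close> edges and the \<open>r\<close>-uniform hypergraph
        supplies the containers.\<close>
      have "coverable good X (indep V h Q)"
        unfolding good_def by (rule rec[OF prems(5) hg degQ]) (use Qlo st 1 in auto)
      then show ?thesis by (rule coverable_mono) (auto simp: 1)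
    next
      case 2
      \<comment> \<open>The scan stops with all live degrees below \<tau>, so few edges are live;
        few vertices are bad, since the degrees in \<open>Q\<close> sum to
        \<open>r * card Q\<close>. By \<open>cnt\<close> the lost edges are charged, at most
        \<open>D\<close> each, to discarded vertices, positive answers and bad vertices. Hence
        \<open>many\<close> forces at least \<open>G\<close> discarded vertices, and
        \<open>V - R\<close> alone is a container.\<close>
      have "card P \<le> (\<Sum>j\<in>P. card (g j))"
        using edge prems(4) sum_bounded_below[of P 1 "\<lambda>j. card (g j)"] by fastforce
      also have "\<dots> = (\<Sum>x\<in>A. hdeg g P x)"
        using sum_hdeg[of A P g] finA finP PA by simp
      finally have "real (card P) \<le> (\<Sum>x\<in>A. real (hdeg g P x))"
        by (metis of_nat_le_iff of_nat_sum)
      also have "\<dots> \<le> \<tau> * card A"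
        using sum_bounded_above[of A "\<lambda>x. real (hdeg g P x)" \<tau>] 2(2) by (force simp: mult.commute)
      also have "\<dots> \<le> \<tau> * card V"
        using pos prems(1) fin by (intro mult_left_mono) (auto intro: card_mono)
      finally have cP: "real (card P) \<le> \<tau> * card V" .
      have "\<Delta> * card (bad h Q) \<le> (\<Sum>x\<in>bad h Q. real (hdeg h Q x))"
        using sum_bounded_below[of "bad h Q" \<Delta> "\<lambda>x. real (hdeg h Q x)"]
        by (simp add: bad_def mult.commute)
      also have "\<dots> \<le> (\<Sum>x\<in>V. real (hdeg h Q x))"
        using fin by (intro sum_mono2) (auto simp: bad_def)
      also have "\<dots> = real (\<Sum>j\<in>Q. card (h j))"
        using sum_hdeg[of V Q h] fin finQ hV by (metis of_nat_sum)
      also have "\<dots> = real r * real (card Q)" using hg by simp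
      also have "\<dots> \<le> r * (D * s)" using Qhi by (intro mult_left_mono) auto
      also have "\<dots> \<le> r * (D * q)" using pos st by (intro mult_left_mono) auto
      finally have cB: "real (card (bad h Q)) \<le> r * (D * q) / \<Delta>"
        using pos by (simp add: field_simps)
      have "\<tau> * card V + D * (q + r * (D * q) / \<Delta> + G) \<le> \<tau> * card V + D * (card R + q + r * (D * q) / \<Delta>)"
      proof -
        have "D * (card R + s + card (bad h Q)) \<le> D * (card R + q + r * (D * q) / \<Delta>)"
          using cB st pos by (intro mult_left_mono) auto
        then show ?thesis using many cnt cP by linarith
      qed
      then have "D * G \<le> D * card R" by (simp add: algebra_simps)
      then have "G \<le> card R" using pos by simp
      moreover have "card (V - R) + card R = card V"
        using prems(2) fin finR by (metis card_Diff_subset card_mono le_add_diff_inverse2)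
      ultimately have "good (V - R)" unfolding good_def
        by (smt (verit) Diff_subset of_nat_add)
      then show ?thesis
        by (rule coverable_single) (use pos in \<open>auto simp: indep_def Suc_le_eq\<close>)
    next
      case 3
      \<comment> \<open>If \<open>v\<close> is discarded, \<open>P1\<close> stays live and
        \<open>Q\<close> is unchanged. If \<open>v\<close> is accepted, the edges of
        \<open>N\<close> move to \<open>Q\<close>, shortened by \<open>v\<close>, and
        \<open>P2\<close> drops the live edges that now contain a bad vertex.\<close>
      define N where "N = {j \<in> P. v \<in> g j}"
      define P1 where "P1 = {j \<in> P. v \<notin> g j}"
      define Q2 where "Q2 = Q \<union> N"
      define h2 where "h2 = (\<lambda>j. if j \<in> N then g j - {v} else h j)"
      define P2 where "P2 = {j \<in> P1. \<forall>x\<in>g j. real (hdeg h2 Q2 x) < \<Delta>}"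
      have cA: "card (A - {v}) < card A" using 3 finA by (metis card_Diff1_less)
      have cA': "card A = card (A - {v}) + 1" using 3 finA
        by (metis One_nat_def Suc_eq_plus1 card_Suc_Diff1)
      have vN: "v \<in> V" using 3 prems(1) by auto
      have cN: "card N = hdeg g P v" by (simp add: N_def hdeg_def)
      have cP: "card P = card P1 + card N"
        using finP by (subst card_Un_disjoint[symmetric]) (auto simp: P1_def N_def intro: arg_cong[where f=card])
      have part1: "coverable good (X * (card (A - {v}) + 1) ^ t)
          (indep V g P1 \<inter> indep V h Q \<inter> {I. I \<inter> insert v R = {}})"
      proof (rule less.hyps[OF cA])
        show "real (card J) \<le> card P1 + D * (card (insert v R) + s + card (bad h Q))"
        proof -
          have "card (insert v R) = card R + 1" using 3 prems(3) finR by (subst card_insert_disjoint) auto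
          then show ?thesis using cnt cP cN degP[of v] by (simp add: algebra_simps)
        qed
        show "\<tau> * s \<le> real (card Q)" "real (card Q) \<le> D * s" "s + t = q" by fact+
      qed (use prems(1-6) PA hg degQ P_ok vN in \<open>auto simp: P1_def dest: PA[THEN subsetD]\<close>)
      have NQ: "N \<inter> Q = {}" using prems(6) by (auto simp: N_def)
      have finN: "finite N" using finP by (simp add: N_def)
      have hdeg2: "hdeg h2 Q2 x = hdeg h Q x + card {j \<in> N. x \<in> g j - {v}}" for x
      proof -
        have "{j \<in> Q2. x \<in> h2 j} = {j \<in> Q. x \<in> h j} \<union> {j \<in> N. x \<in> g j - {v}}"
          using NQ by (auto simp: Q2_def h2_def)
        then show ?thesis unfolding hdeg_def
          using NQ finN finQ by (simp only:) (subst card_Un_disjoint, auto)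
      qed
      have bad_mono: "bad h Q \<subseteq> bad h2 Q2" by (auto simp: bad_def hdeg2)
      have part2: "coverable good (X * (card (A - {v}) + 1) ^ (t - 1))
          (indep V g P2 \<inter> indep V h2 Q2 \<inter> {I. I \<inter> R = {}})"
      proof (rule less.hyps[OF cA])
        \<comment> \<open>Only a vertex on a live edge through \<open>v\<close> gains degree. Such a
          vertex was not bad, so it starts below \<Delta>, and it gains at most its codegree with
          \<open>v\<close>.\<close>
        show "real (hdeg h2 Q2 x) \<le> \<Delta> + K" for x
        proof (cases "{j \<in> N. x \<in> g j - {v}} = {}")
          case True then show ?thesis using degQ[of x] by (simp only: hdeg2) simp
        next
          case False
          then obtain j where j: "j \<in> P" "x \<in> g j" "x \<noteq> v" by (auto simp: N_def)
          have "card {j \<in> N. x \<in> g j - {v}} \<le> card {j \<in> J. x \<in> g j \<and> v \<in> g j}"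
            using prems(4) fin by (intro card_mono) (auto simp: N_def)
          then show ?thesis using P_ok[OF j(1,2)] codeg[OF j(3)] by (simp add: hdeg2)
        qed
        show "h2 j \<subseteq> g j \<and> card (h2 j) = r" if "j \<in> Q2" for j
        proof (cases "j \<in> N")
          case True
          then have "v \<in> g j" "card (g j) = Suc r" using edge prems(4) by (auto simp: N_def)
          then show ?thesis using True by (auto simp: h2_def)
        next
          case False
          then show ?thesis using that hg by (auto simp: h2_def Q2_def)
        qed
        have cQ2: "card Q2 = card Q + card N"
          unfolding Q2_def using NQ finN finQ by (subst card_Un_disjoint) auto
        show "\<tau> * (s + 1 :: nat) \<le> real (card Q2)" using Qlo 3 cN cQ2 by (simp add: algebra_simps)
        show "real (card Q2) \<le> D * (s + 1 :: nat)" using Qhi degP[of v] cN cQ2 by (simp add: algebra_simps)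
        show "s + 1 + (t - 1) = q" using st 3 by simp
        \<comment> \<open>Live edges had no bad vertex before, so each dropped edge meets a newly
          bad one; the growth of \<open>bad\<close> in \<open>cnt\<close> pays for the loss.\<close>
        have "real (card (P1 - P2)) \<le> D * card (bad h2 Q2 - bad h Q)"
        proof (rule card_meeting_le[where g=g, OF finP _ degP])
          fix j assume "j \<in> P1 - P2"
          then obtain x where x: "j \<in> P" "x \<in> g j" "\<Delta> \<le> real (hdeg h2 Q2 x)"
            by (auto simp: P1_def P2_def not_less)
          then have "x \<in> V" using edge prems(4) by blast
          then show "g j \<inter> (bad h2 Q2 - bad h Q) \<noteq> {}"
            using x P_ok[OF x(1,2)] by (auto simp: bad_def)
        qed (use finbad in \<open>auto simp: P1_def\<close>)
        moreover have "card P1 = card P2 + card (P1 - P2)"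
          using finP by (subst card_Un_disjoint[symmetric]) (auto simp: P1_def P2_def intro: arg_cong[where f=card])
        moreover have "card (bad h2 Q2) = card (bad h Q) + card (bad h2 Q2 - bad h Q)"
          using finbad bad_mono by (metis card_Diff_subset card_mono le_add_diff_inverse)
        ultimately show "real (card J) \<le> card P2 + D * (card R + (s + 1 :: nat) + card (bad h2 Q2))"
          using cnt cP cN degP[of v] by (simp add: algebra_simps)
      qed (use prems(1-6) PA in \<open>auto simp: P1_def P2_def Q2_def N_def dest: PA[THEN subsetD]\<close>)
      have sub: "indep V g P \<inter> indep V h Q \<inter> {I. I \<inter> R = {}} \<subseteq>
          (indep V g P1 \<inter> indep V h Q \<inter> {I. I \<inter> insert v R = {}}) \<union>
          (indep V g P2 \<inter> indep V h2 Q2 \<inter> {I. I \<inter> R = {}})"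
      proof
        fix I assume I: "I \<in> indep V g P \<inter> indep V h Q \<inter> {I. I \<inter> R = {}}"
        show "I \<in> (indep V g P1 \<inter> indep V h Q \<inter> {I. I \<inter> insert v R = {}}) \<union>
          (indep V g P2 \<inter> indep V h2 Q2 \<inter> {I. I \<inter> R = {}})"
        proof (cases "v \<in> I")
          case True
          \<comment> \<open>As \<open>v\<close> lies in \<open>I\<close>, an edge of
            \<open>N\<close> shortened by \<open>v\<close> is contained in \<open>I\<close> only if
            the full edge is.\<close>
          have "\<not> h2 j \<subseteq> I" if "j \<in> Q2" for j
            using that I True by (auto simp: indep_def h2_def Q2_def N_def)
          then show ?thesis using I by (auto simp: indep_def P1_def P2_def)
        next
          case False
          then show ?thesis using I by (auto simp: indep_def P1_def)
        qed
      qed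
      let ?a = "card (A - {v}) + 1"
      have "X * ?a ^ t + X * ?a ^ (t - 1) = X * (?a ^ t + ?a ^ (t - 1))"
        by (simp only: distrib_left)
      also have "\<dots> \<le> X * (?a + 1) ^ t"
        by (intro mult_le_mono2 power_add_pred_le) (use 3 in auto)
      finally have "X * ?a ^ t + X * ?a ^ (t - 1) \<le> X * (card A + 1) ^ t"
        using cA' by simp
      then show ?thesis
        by (rule coverable_mono[OF coverable_Un[OF part1 part2] sub])
    qed
  qed
  \<comment> \<open>Initially all vertices are unscanned, all edges live and \<open>Q\<close> empty;
    the last two sets in the intersection impose no further restriction.\<close>
  have "coverable good (X * (card V + 1) ^ q) (indep V g J \<inter> indep V g {} \<inter> {I. I \<inter> {} = {}})"
    by (rule main[where s=0]) (use edge pos in \<open>auto simp: hdeg_def\<close>)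
  then show ?thesis
    unfolding good_def by (rule coverable_mono) (auto simp: indep_def)
qed

section \<open>Lowering the uniformity and iterating the containers\<close>

definition bounded_hypergraph ::
    "'a set \<Rightarrow> 'j set \<Rightarrow> ('j \<Rightarrow> 'a set) \<Rightarrow> nat \<Rightarrow> real \<Rightarrow> real \<Rightarrow> bool" where
  "bounded_hypergraph V J g r D K \<longleftrightarrow> finite V \<and> finite J \<and>
     (\<forall>j\<in>J. g j \<subseteq> V \<and> card (g j) = r) \<and> (\<forall>x. real (hdeg g J x) \<le> D) \<and>
     (\<forall>x y. x \<noteq> y \<longrightarrow> real (card {j \<in> J. x \<in> g j \<and> y \<in> g j}) \<le> K)"

text \<open>\<open>M\<close> is a scale for the number of vertices that stays fixed while the vertex
  set shrinks; \<open>q\<close> is the number of positive answers per pass.\<close>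

definition container_params :: "nat \<Rightarrow> real \<Rightarrow> real \<Rightarrow> real \<Rightarrow> real \<Rightarrow> nat \<Rightarrow> bool" where
  "container_params r \<gamma> M D K q \<longleftrightarrow>
     0 < D \<and> 0 \<le> K \<and> 0 < M \<and> 0 < q \<and> q \<le> \<gamma> * M \<and> K \<le> (q / M) ^ (r - 1) * D"

text \<open>
  Shortening edges never increases the codegree bound \<open>K\<close>, while it multiplies the degree scale \<open>D\<close>
  by about \<open>q / M\<close>. This is why \<open>K \<le> (q / M) ^ (r - 1) * D\<close> suffices for all the \<open>r - 1\<close> passes.
\<close>

lemma shrinking_containers:
  fixes \<epsilon> :: real
  assumes "1 \<le> r" "0 < \<epsilon>"
  shows "\<exists>\<gamma>>0. \<forall>(V::'a set) (J::'j set) g (M::real) (D::real) (K::real) (q::nat).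
    bounded_hypergraph V J g r D K \<and> container_params r \<gamma> M D K q \<and>
    card V \<le> M \<and> \<epsilon> * D * M \<le> card J \<longrightarrow>
    coverable (\<lambda>C. C \<subseteq> V \<and> card C + \<gamma> * M \<le> card V) ((card V + 1) ^ (q * (r - 1))) (indep V g J)"
  using assms
proof (induction r arbitrary: \<epsilon> rule: dec_induct)
  case base
  show ?case
  proof (intro exI[of _ \<epsilon>] conjI allI impI)
    show "0 < \<epsilon>" by fact
    fix V :: "'a set" and J :: "'j set" and g and M D K :: real and q :: nat
    assume *: "bounded_hypergraph V J g 1 D K \<and> container_params 1 \<epsilon> M D K q \<and>
      card V \<le> M \<and> \<epsilon> * D * M \<le> card J"
    \<comment> \<open>When edges are singletons, an independent set avoids all of \<open>R\<close>,
      so \<open>V - R\<close> is the only container and nothing is chosen.\<close>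
    define R where "R = (\<Union>j\<in>J. g j)"
    have finV: "finite V" and edge: "\<And>j. j \<in> J \<Longrightarrow> g j \<subseteq> V \<and> card (g j) = 1"
      using * by (simp_all add: bounded_hypergraph_def)
    have RV: "R \<subseteq> V" using edge unfolding R_def by blast
    then have finR: "finite R" using finV by (rule finite_subset)
    have "real (card J) \<le> D * card R"
    proof (rule card_meeting_le[where g=g and J=J])
      show "g j \<inter> R \<noteq> {}" if "j \<in> J" for j
      proof -
        have "g j \<noteq> {}" "g j \<subseteq> R" using edge[OF that] that unfolding R_def by auto
        then show ?thesis by blast
      qed
    qed (use * finR in \<open>auto simp: bounded_hypergraph_def\<close>)
    then have "D * (\<epsilon> * M) \<le> D * card R" using * by (simp add: mult_ac)
    then have "\<epsilon> * M \<le> card R" using * by (simp add: container_params_def)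
    moreover have "card (V - R) + card R = card V"
      using RV finR finV by (metis card_Diff_subset card_mono le_add_diff_inverse2)
    ultimately have "card (V - R) + \<epsilon> * M \<le> card V" by linarith
    then show "coverable (\<lambda>C. C \<subseteq> V \<and> card C + \<epsilon> * M \<le> card V) ((card V + 1) ^ (q * (1 - 1))) (indep V g J)"
    proof (intro coverable_single[of _ "V - R"])
      fix I assume I: "I \<in> indep V g J"
      have "x \<notin> I" if "x \<in> g j" "j \<in> J" for x j
      proof -
        have "g j = {x}" using edge[OF that(2)] that(1) by (metis card_1_singletonE singletonD)
        then show ?thesis using I that by (auto simp: indep_def)
      qed
      then show "I \<subseteq> V - R" using I by (auto simp: R_def indep_def)
    qed auto
  qed
next
  case (step r)
  \<comment> \<open>With the threshold \<open>\<Delta> = \<kappa> * (D * q / M)\<close>, the at most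
    \<open>r * (D * q) / \<Delta>\<close> bad vertices number at most
    \<open>\<epsilon> / 4 * M\<close>.\<close>
  define \<kappa> where "\<kappa> = 4 * r / \<epsilon> + 1"
  have \<kappa>: "\<kappa> > 1" "r / \<kappa> \<le> \<epsilon> / 4"
    using step by (auto simp: \<kappa>_def field_simps)
  \<comment> \<open>The shortened hypergraph has at least \<open>\<epsilon> * D / 4 * q\<close>
    edges and degree bound at most \<open>(\<kappa> + 1) * D * q / M\<close>; this is its edge
    density relative to that bound and \<open>M\<close>.\<close>
  define \<epsilon>' where "\<epsilon>' = \<epsilon> / (4 * (\<kappa> + 1))"
  have "\<epsilon>' > 0" using \<kappa> step by (simp add: \<epsilon>'_def)
  from step.IH[OF this] obtain \<gamma>' where \<gamma>': "\<gamma>' > 0" and IH: "\<And>(V::'a set) (J::'j set) g (M::real) (D::real) (K::real) (q::nat).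
    bounded_hypergraph V J g r D K \<Longrightarrow> container_params r \<gamma>' M D K q \<Longrightarrow>
    card V \<le> M \<Longrightarrow> \<epsilon>' * D * M \<le> card J \<Longrightarrow>
    coverable (\<lambda>C. C \<subseteq> V \<and> card C + \<gamma>' * M \<le> card V) ((card V + 1) ^ (q * (r - 1))) (indep V g J)"
    by auto
  \<comment> \<open>The three bounds ensure \<open>q \<le> M\<close>, keep \<open>q\<close> and the
    required shrinkage within a quarter of the budget, and let the containers of lower uniformity
    shrink enough.\<close>
  define \<gamma> where "\<gamma> = min 1 (min (\<epsilon> / 4) \<gamma>')"
  have \<gamma>: "\<gamma> > 0" "\<gamma> \<le> 1" "\<gamma> \<le> \<epsilon> / 4" "\<gamma> \<le> \<gamma>'" using \<gamma>' step by (auto simp: \<gamma>_def)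
  show ?case
  proof (intro exI[of _ \<gamma>] conjI allI impI)
    show "\<gamma> > 0" by fact
    fix V :: "'a set" and J :: "'j set" and g and M D K :: real and q :: nat
    assume *: "bounded_hypergraph V J g (Suc r) D K \<and> container_params (Suc r) \<gamma> M D K q \<and>
      card V \<le> M \<and> \<epsilon> * D * M \<le> card J"
    then have pos: "0 < D" "0 \<le> K" "0 < M" "0 < q" and q: "q \<le> \<gamma> * M"
      and K: "K \<le> (q / M) ^ r * D" and VM: "card V \<le> M" and J: "\<epsilon> * D * M \<le> card J"
      by (auto simp: container_params_def)
    have H: "finite V" "finite J" "\<And>j. j \<in> J \<Longrightarrow> g j \<subseteq> V \<and> card (g j) = Suc r"
      "\<And>x. real (hdeg g J x) \<le> D"
      "\<And>x y. x \<noteq> y \<Longrightarrow> real (card {j \<in> J. x \<in> g j \<and> y \<in> g j}) \<le> K"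
      using * by (auto simp: bounded_hypergraph_def)
    define \<Delta> where "\<Delta> = \<kappa> * (D * q / M)"
    have \<Delta>: "0 < \<Delta>" using pos \<kappa> by (simp add: \<Delta>_def)
    have qM: "q \<le> M" using q \<gamma>(2) pos mult_right_mono[of \<gamma> 1 M] by linarith
    have r0: "r > 0" using step by simp
    have Kq: "K \<le> D * q / M"
    proof -
      have "(q / M) ^ r \<le> (q / M) ^ 1" using qM pos r0 by (intro power_decreasing) auto
      then have "(q / M) ^ r * D \<le> (q / M) * D" using pos by (intro mult_right_mono) auto
      then show ?thesis using K by (simp add: mult.commute)
    qed
    \<comment> \<open>The edge budget \<open>\<epsilon> * D * M\<close> is split into quarters:
      edges still live, positive answers, bad vertices, and discarded vertices.\<close>
    have "coverable (\<lambda>C. C \<subseteq> V \<and> card C + \<gamma> * M \<le> card V)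
       ((card V + 1) ^ (q * (r - 1)) * (card V + 1) ^ q) (indep V g J)"
    proof (rule scan_vertices[where D=D and K=K and \<Delta>=\<Delta> and \<tau>="\<epsilon> * D / 4" and r=r])
      have eq: "r * (D * q) / \<Delta> = r / \<kappa> * M"
        using pos \<kappa> by (simp add: \<Delta>_def field_simps)
      also have "\<dots> \<le> \<epsilon> / 4 * M" using \<kappa> pos by (intro mult_right_mono) auto
      finally have 1: "r * (D * q) / \<Delta> \<le> \<epsilon> / 4 * M" .
      have 2: "\<gamma> * M \<le> \<epsilon> / 4 * M" using \<gamma> pos by (intro mult_right_mono) auto
      have "D * (q + r * (D * q) / \<Delta> + \<gamma> * M) \<le> D * (\<epsilon> / 4 * M + \<epsilon> / 4 * M + \<epsilon> / 4 * M)"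
        using 1 2 order_trans[OF q 2] pos by (intro mult_left_mono add_mono) auto
      moreover have "\<epsilon> * D / 4 * card V \<le> \<epsilon> * D / 4 * M"
        using VM pos step by (intro mult_left_mono) auto
      moreover have "D * (\<epsilon> / 4 * M + \<epsilon> / 4 * M + \<epsilon> / 4 * M) + \<epsilon> * D / 4 * M = \<epsilon> * D * M"
        by (simp add: field_simps)
      ultimately show "\<epsilon> * D / 4 * card V + D * (q + r * (D * q) / \<Delta> + \<gamma> * M) \<le> card J"
        using J by linarith
      show "0 < \<epsilon> * D / 4" using pos step by simp
      fix Q h
      assume Q: "Q \<subseteq> J" and h: "\<And>j. j \<in> Q \<Longrightarrow> h j \<subseteq> g j \<and> card (h j) = r"
        and hdeg: "\<And>x. real (hdeg h Q x) \<le> \<Delta> + K" and cQ: "\<epsilon> * D / 4 * q \<le> card Q"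
      have bh: "bounded_hypergraph V Q h r (\<Delta> + K) K"
        unfolding bounded_hypergraph_def
      proof (intro conjI allI ballI impI)
        show "finite Q" using Q H(2) finite_subset by blast
        show "h j \<subseteq> V" "card (h j) = r" if "j \<in> Q" for j using h[OF that] H(3) Q that by auto
        show "real (card {j \<in> Q. x \<in> h j \<and> y \<in> h j}) \<le> K" if "x \<noteq> y" for x y
        proof -
          have "card {j \<in> Q. x \<in> h j \<and> y \<in> h j} \<le> card {j \<in> J. x \<in> g j \<and> y \<in> g j}"
            using Q h H(2) by (intro card_mono) auto
          then show ?thesis using H(5)[OF that] by linarith
        qed
      qed (use H hdeg in auto)
      have cp: "container_params r \<gamma>' M (\<Delta> + K) K q"
        unfolding container_params_def
      proof (intro conjI)
        show "q \<le> \<gamma>' * M" using q \<gamma>(4) pos mult_right_mono[of \<gamma> \<gamma>' M] by linarith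
        have "D * q / M \<le> \<Delta> + K"
          using pos \<kappa> mult_right_mono[of 1 \<kappa> "D * q / M"] by (simp add: \<Delta>_def)
        then have "(q / M) ^ (r - 1) * (D * q / M) \<le> (q / M) ^ (r - 1) * (\<Delta> + K)"
          using pos by (intro mult_left_mono) auto
        moreover have "(q / M) ^ r * D = (q / M) ^ (r - 1) * (D * q / M)"
          using r0 by (cases r) (auto simp: mult_ac)
        ultimately show "K \<le> (q / M) ^ (r - 1) * (\<Delta> + K)" using K by linarith
      qed (use pos \<Delta> in auto)
      have "(\<Delta> + K) * M \<le> (\<kappa> * (D * q / M) + D * q / M) * M"
        using Kq pos by (intro mult_right_mono) (auto simp: \<Delta>_def)
      also have "\<dots> = (\<kappa> + 1) * (D * q)" using pos by (simp add: field_simps)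
      finally have "\<epsilon>' * ((\<Delta> + K) * M) \<le> \<epsilon>' * ((\<kappa> + 1) * (D * q))"
        using \<open>\<epsilon>' > 0\<close> by (intro mult_left_mono) auto
      also have "\<dots> = \<epsilon> * D / 4 * q" using \<kappa> by (simp add: \<epsilon>'_def field_simps)
      finally have "\<epsilon>' * (\<Delta> + K) * M \<le> card Q" using cQ by (simp add: mult.assoc)
      from IH[OF bh cp VM this]
      show "coverable (\<lambda>C. C \<subseteq> V \<and> card C + \<gamma> * M \<le> card V) ((card V + 1) ^ (q * (r - 1))) (indep V h Q)"
      proof (rule coverable_mono)
        have "\<gamma> * M \<le> \<gamma>' * M" using \<gamma> pos by (intro mult_right_mono) auto
        then show "C \<subseteq> V \<and> card C + \<gamma> * M \<le> card V" if "C \<subseteq> V \<and> card C + \<gamma>' * M \<le> card V" for C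
          using that by auto
      qed auto
    qed (use H pos \<Delta> in auto)
    moreover have "(card V + 1) ^ (q * (r - 1)) * (card V + 1) ^ q = (card V + 1) ^ (q * (Suc r - 1))"
      using r0 by (cases r) (auto simp: power_add mult.commute)
    ultimately show "coverable (\<lambda>C. C \<subseteq> V \<and> card C + \<gamma> * M \<le> card V)
      ((card V + 1) ^ (q * (Suc r - 1))) (indep V g J)" by simp
  qed
qed

text \<open>A container with too many edges is split again, losing at least
  \<open>\<gamma> * M\<close> vertices each time. Since there are at most \<open>M\<close> to begin
  with, \<open>m \<ge> 1 / \<gamma>\<close> rounds suffice.\<close>

lemma hypergraph_containers:
  fixes \<epsilon> :: real
  assumes "1 \<le> r" "0 < \<epsilon>"
  shows "\<exists>\<gamma>>0. \<exists>m. \<forall>(V::'a set) (J::'j set) g (M::real) (D::real) (K::real) (q::nat).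
    bounded_hypergraph V J g r D K \<and> container_params r \<gamma> M D K q \<and> card V \<le> M \<longrightarrow>
    coverable (\<lambda>C. C \<subseteq> V \<and> card {j \<in> J. g j \<subseteq> C} \<le> \<epsilon> * D * M)
      ((card V + 1) ^ (q * (r - 1) * m)) (indep V g J)"
proof -
  obtain \<gamma> where \<gamma>: "\<gamma> > 0" and step: "\<And>(V::'a set) (J::'j set) g (M::real) (D::real) (K::real) (q::nat).
    bounded_hypergraph V J g r D K \<Longrightarrow> container_params r \<gamma> M D K q \<Longrightarrow>
    card V \<le> M \<Longrightarrow> \<epsilon> * D * M \<le> card J \<Longrightarrow>
    coverable (\<lambda>C. C \<subseteq> V \<and> card C + \<gamma> * M \<le> card V) ((card V + 1) ^ (q * (r - 1))) (indep V g J)"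
    using shrinking_containers[OF assms, where 'a='a and 'j='j] by blast
  obtain m :: nat where m: "1 / \<gamma> \<le> m" using real_arch_simple by blast
  show ?thesis
  proof (intro exI[of _ \<gamma>] exI[of _ m] conjI allI impI)
    show "\<gamma> > 0" by fact
    fix V :: "'a set" and J :: "'j set" and g and M D K :: real and q :: nat
    assume "bounded_hypergraph V J g r D K \<and> container_params r \<gamma> M D K q \<and> card V \<le> M"
    then have H: "bounded_hypergraph V J g r D K" and cp: "container_params r \<gamma> M D K q"
      and VM: "card V \<le> M" by auto
    then have fin: "finite V" "finite J" and edge: "\<And>j. j \<in> J \<Longrightarrow> g j \<subseteq> V \<and> card (g j) = r"
      and D: "0 < D" and M: "0 < M"
      by (auto simp: bounded_hypergraph_def container_params_def)
    let ?few = "\<lambda>C. card {j \<in> J. g j \<subseteq> C} \<le> \<epsilon> * D * M"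
    \<comment> \<open>Here \<open>i\<close> bounds the rounds still needed for \<open>W\<close>. At
      \<open>i = 0\<close> the set \<open>W\<close> is empty and contains no edge, because
      \<open>r \<ge> 1\<close>. The base \<open>card V + 1\<close> is kept so that every round costs
      the same.\<close>
    have *: "coverable (\<lambda>C. C \<subseteq> V \<and> ?few C) ((card V + 1) ^ (q * (r - 1) * i)) (indep V g J \<inter> Pow W)"
      if "W \<subseteq> V" "card W \<le> i * (\<gamma> * M)" for W i
      using that
    proof (induction i arbitrary: W)
      case 0
      then have "W = {}" using fin by (metis card_eq_0_iff finite_subset mult_zero_left
            of_nat_0 of_nat_le_0_iff)
      moreover have "{j \<in> J. g j \<subseteq> {}} = {}" using edge assms by fastforce
      then have "?few {}" using assms D M by (simp only: card.empty) simp
      ultimately show ?case by (intro coverable_single[of _ "{}"]) auto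
    next
      case (Suc i)
      show ?case
      proof (cases "?few W")
        case True
        then show ?thesis using Suc.prems by (intro coverable_single[of _ W]) auto
      next
        case False
        define J' where "J' = {j \<in> J. g j \<subseteq> W}"
        have WV: "card W \<le> card V" and finW: "finite W"
          using Suc.prems fin by (auto intro: card_mono finite_subset)
        have "bounded_hypergraph W J' g r D K"
          unfolding bounded_hypergraph_def
        proof (intro conjI allI ballI impI)
          fix x
          have "hdeg g J' x \<le> hdeg g J x"
            unfolding hdeg_def J'_def using fin by (intro card_mono) auto
          then show "real (hdeg g J' x) \<le> D" using H by (smt (verit) bounded_hypergraph_def of_nat_mono)
          fix y assume "x \<noteq> y"
          have "card {j \<in> J'. x \<in> g j \<and> y \<in> g j} \<le> card {j \<in> J. x \<in> g j \<and> y \<in> g j}"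
            unfolding J'_def using fin by (intro card_mono) auto
          also have "real \<dots> \<le> K" using H \<open>x \<noteq> y\<close> by (simp add: bounded_hypergraph_def)
          finally show "real (card {j \<in> J'. x \<in> g j \<and> y \<in> g j}) \<le> K" by simp
        qed (use finW fin edge in \<open>auto simp: J'_def\<close>)
        then have "coverable (\<lambda>C. C \<subseteq> W \<and> card C + \<gamma> * M \<le> card W) ((card W + 1) ^ (q * (r - 1))) (indep W g J')"
          using cp by (rule step) (use WV VM False in \<open>auto simp: J'_def\<close>)
        then have "coverable (\<lambda>C. C \<subseteq> W \<and> card C + \<gamma> * M \<le> card W) ((card V + 1) ^ (q * (r - 1))) (indep V g J \<inter> Pow W)"
          by (rule coverable_mono) (use WV in \<open>auto simp: indep_def J'_def intro: power_mono\<close>)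
        then have "coverable (\<lambda>C. C \<subseteq> V \<and> ?few C) ((card V + 1) ^ (q * (r - 1)) * (card V + 1) ^ (q * (r - 1) * i))
          (indep V g J \<inter> Pow W)"
        proof (rule coverable_trans)
          fix C assume C: "C \<subseteq> W \<and> card C + \<gamma> * M \<le> card W"
          then have "coverable (\<lambda>C. C \<subseteq> V \<and> ?few C) ((card V + 1) ^ (q * (r - 1) * i)) (indep V g J \<inter> Pow C)"
            using Suc.prems by (intro Suc.IH) (auto simp: algebra_simps)
          then show "coverable (\<lambda>C. C \<subseteq> V \<and> ?few C) ((card V + 1) ^ (q * (r - 1) * i)) (indep V g J \<inter> Pow W \<inter> Pow C)"
            by (rule coverable_mono) auto
        qed
        then show ?thesis by (simp add: power_add)
      qed
    qed
    have "M \<le> m * (\<gamma> * M)" using m \<gamma> M by (simp add: field_simps)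
    then have "coverable (\<lambda>C. C \<subseteq> V \<and> ?few C) ((card V + 1) ^ (q * (r - 1) * m)) (indep V g J \<inter> Pow V)"
      using VM by (intro *) auto
    then show "coverable (\<lambda>C. C \<subseteq> V \<and> ?few C) ((card V + 1) ^ (q * (r - 1) * m)) (indep V g J)"
      by (rule coverable_mono) (auto simp: indep_def)
  qed
qed

subsection \<open>The hypergraph of forbidden coloured copies\<close>

lemma finite_K_edges: "finite (K_edges n)"
  by (rule finite_subset[of _ "Pow {1..n}"]) (auto simp: K_edges_def)

lemma card_K_edges: "card (K_edges n) = n choose 2"
  using n_subsets[of "{1..n}" 2] by (simp add: K_edges_def)

lemma order_embeddings_inj:
  assumes "\<phi> \<in> order_embeddings N n"
  shows "inj_on \<phi> {1..N}" "\<phi> ` {1..N} \<subseteq> {1..n}"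
  using assms by (auto simp: order_embeddings_def)

lemma finite_order_embeddings: "finite (order_embeddings N n)"
  by (rule finite_subset[of _ "{1..N} \<rightarrow>\<^sub>E {1..n}"]) (auto simp: order_embeddings_def finite_PiE)

lemma order_embeddings_image_edge:
  assumes "\<phi> \<in> order_embeddings N n" "e \<in> K_edges N"
  shows "\<phi> ` e \<in> K_edges n"
proof -
  have "card (\<phi> ` e) = card e"
    using assms order_embeddings_inj(1)[OF assms(1)]
    by (intro card_image) (auto simp: K_edges_def intro: inj_on_subset)
  then show ?thesis
    using assms(2) order_embeddings_inj(2)[OF assms(1)] by (auto simp: K_edges_def)
qed

lemma order_embeddings_inj_edges:
  assumes "\<phi> \<in> order_embeddings N n"
  shows "inj_on ((`) \<phi>) (K_edges N)"
  using order_embeddings_inj(1)[OF assms]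
  by (intro inj_onI) (auto simp: K_edges_def inj_on_image_eq_iff)

text \<open>The values of an increasing map form the sorted list of its image. Embeddings can
  therefore be counted as \<open>N\<close>-subsets.\<close>

lemma order_embeddings_image_inj:
  "inj_on (\<lambda>\<phi>. \<phi> ` {1..N}) (order_embeddings N n)"
proof (rule inj_onI)
  fix \<phi> \<psi> assume *: "\<phi> \<in> order_embeddings N n" "\<psi> \<in> order_embeddings N n" "\<phi> ` {1..N} = \<psi> ` {1..N}"
  have set: "set [1..<Suc N] = {1..N}" by auto
  have sorted: "sorted (map \<chi> [1..<Suc N]) \<and> distinct (map \<chi> [1..<Suc N])"
    if "\<chi> \<in> order_embeddings N n" for \<chi>
  proof
    show "sorted (map \<chi> [1..<Suc N])"
      by (rule sorted_map_mono) (use that set in \<open>auto simp: order_embeddings_def simp del: upt_Suc\<close>)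
    show "distinct (map \<chi> [1..<Suc N])"
      using that set by (simp add: distinct_map order_embeddings_def del: upt_Suc)
  qed
  have "map \<phi> [1..<Suc N] = map \<psi> [1..<Suc N]"
    by (rule sorted_distinct_set_unique) (use sorted *(1,2) *(3) set in \<open>auto simp del: upt_Suc\<close>)
  then have "\<forall>x\<in>{1..N}. \<phi> x = \<psi> x" using set by (metis map_eq_conv)
  then show "\<phi> = \<psi>"
    using *(1,2) by (intro PiE_ext[of \<phi> "{1..N}" "\<lambda>_. {1..n}"]) (auto simp: order_embeddings_def)
qed

text \<open>A superset \<open>U\<close> of \<open>Y\<close> is determined by \<open>U - Y\<close>,
  which leaves \<open>N - card Y\<close> vertices to choose.\<close>

lemma card_supersets_le:
  assumes "finite Y" "card Y \<le> N"
  shows "card {U. U \<subseteq> {1..n} \<and> card U = N \<and> Y \<subseteq> U} \<le> n ^ (N - card Y)"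
proof -
  have "card {U. U \<subseteq> {1..n} \<and> card U = N \<and> Y \<subseteq> U} \<le> card {W. W \<subseteq> {1..n} \<and> card W = N - card Y}"
  proof (rule card_inj_on_le[where f="\<lambda>U. U - Y"])
    show "inj_on (\<lambda>U. U - Y) {U. U \<subseteq> {1..n} \<and> card U = N \<and> Y \<subseteq> U}" by (rule inj_onI) auto
    show "(\<lambda>U. U - Y) ` {U. U \<subseteq> {1..n} \<and> card U = N \<and> Y \<subseteq> U} \<subseteq> {W. W \<subseteq> {1..n} \<and> card W = N - card Y}"
      using assms by (auto simp: card_Diff_subset)
  qed auto
  also have "\<dots> = n choose (N - card Y)" using n_subsets[of "{1..n}" "N - card Y"] by simp
  also have "\<dots> \<le> n ^ (N - card Y)"
    by (cases "N - card Y \<le> n") (auto simp: binomial_le_pow binomial_eq_0)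
  finally show ?thesis .
qed

lemma card_embeddings_onto_superset_le:
  assumes "finite Y" "card Y \<le> N"
  shows "card {\<phi> \<in> order_embeddings N n. Y \<subseteq> \<phi> ` {1..N}} \<le> n ^ (N - card Y)"
proof -
  have "card {\<phi> \<in> order_embeddings N n. Y \<subseteq> \<phi> ` {1..N}}
      \<le> card {U. U \<subseteq> {1..n} \<and> card U = N \<and> Y \<subseteq> U}"
  proof (rule card_inj_on_le[where f="\<lambda>\<phi>. \<phi> ` {1..N}"])
    show "inj_on (\<lambda>\<phi>. \<phi> ` {1..N}) {\<phi> \<in> order_embeddings N n. Y \<subseteq> \<phi> ` {1..N}}"
      using order_embeddings_image_inj by (rule inj_on_subset) auto
    show "(\<lambda>\<phi>. \<phi> ` {1..N}) ` {\<phi> \<in> order_embeddings N n. Y \<subseteq> \<phi> ` {1..N}}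
      \<subseteq> {U. U \<subseteq> {1..n} \<and> card U = N \<and> Y \<subseteq> U}"
    proof (rule image_subsetI)
      fix \<phi> assume \<phi>: "\<phi> \<in> {\<phi> \<in> order_embeddings N n. Y \<subseteq> \<phi> ` {1..N}}"
      then have "inj_on \<phi> {1..N}" "\<phi> ` {1..N} \<subseteq> {1..n}"
        using order_embeddings_inj[of \<phi> N n] by blast+
      then show "\<phi> ` {1..N} \<in> {U. U \<subseteq> {1..n} \<and> card U = N \<and> Y \<subseteq> U}"
        using \<phi> card_image[of \<phi> "{1..N}"] by simp
    qed
  qed auto
  then show ?thesis using card_supersets_le[OF assms, of n] by linarith
qed

section \<open>Degrees and codegrees of coloured copies\<close>

lemma finite_colourings: "finite (colourings k n)"
  by (simp add: colourings_def finite_PiE finite_K_edges)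

lemma card_colourings: "card (colourings k n) = k ^ (n choose 2)"
  by (simp add: colourings_def card_PiE finite_K_edges card_K_edges)

text \<open>Pairing edges with colours makes containment of this set in the pairs of a template say
  that the colouring realises the restricted template.\<close>

definition copy_vertices :: "nat \<Rightarrow> (nat \<Rightarrow> nat) \<times> (nat set \<Rightarrow> nat) \<Rightarrow> (nat set \<times> nat) set" where
  "copy_vertices N p = (\<lambda>e. (fst p ` e, snd p e)) ` K_edges N"

text \<open>A pair (edge, colour) fixes two vertices of the image of \<phi>; two distinct pairs in
  one copy fix at least three, which saves a factor \<open>n\<close>. The factor
  \<open>real k ^ (N choose 2)\<close> bounds the choice of \<open>c\<close>.\<close>

lemma bounded_hypergraph_copies:
  assumes "2 \<le> N" "1 \<le> n" "F \<subseteq> colourings k N"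
  defines "D \<equiv> real k ^ (N choose 2) * real n ^ (N - 2)"
  shows "bounded_hypergraph (K_edges n \<times> {1..k}) (order_embeddings N n \<times> F) (copy_vertices N)
    (N choose 2) D (D / n)"
proof -
  have finF: "finite F" using assms finite_colourings finite_subset by blast
  have "card F \<le> k ^ (N choose 2)"
    using card_mono[OF finite_colourings assms(3)] by (simp add: card_colourings)
  then have cF: "real (card F) \<le> real k ^ (N choose 2)" by (metis of_nat_le_iff of_nat_power)
  have fin: "finite {\<phi> \<in> order_embeddings N n. Y \<subseteq> \<phi> ` {1..N}}" for Y
    using finite_order_embeddings by simp
  have sub: "fst x \<subseteq> \<phi> ` {1..N}" "card (fst x) = 2"
    if \<phi>: "\<phi> \<in> order_embeddings N n" and x: "x \<in> copy_vertices N (\<phi>, c)" for x \<phi> c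
  proof -
    obtain e where e: "e \<in> K_edges N" "fst x = \<phi> ` e"
      using x by (auto simp: copy_vertices_def)
    then show "fst x \<subseteq> \<phi> ` {1..N}" by (auto simp: K_edges_def)
    show "card (fst x) = 2"
      using order_embeddings_image_edge[OF \<phi> e(1)] e(2) by (simp add: K_edges_def)
  qed
  have bound: "real (card S) \<le> real k ^ (N choose 2) * b"
    if S: "S \<subseteq> {\<phi> \<in> order_embeddings N n. Y \<subseteq> \<phi> ` {1..N}} \<times> F"
      and b: "real (card {\<phi> \<in> order_embeddings N n. Y \<subseteq> \<phi> ` {1..N}}) \<le> b" for S Y b
  proof -
    have "card S \<le> card {\<phi> \<in> order_embeddings N n. Y \<subseteq> \<phi> ` {1..N}} * card F"
      using card_mono[OF _ S] fin finF by (simp add: card_cartesian_product)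
    then have "real (card S) \<le> card {\<phi> \<in> order_embeddings N n. Y \<subseteq> \<phi> ` {1..N}} * real (card F)"
      by (metis of_nat_le_iff of_nat_mult)
    also have "\<dots> \<le> b * real k ^ (N choose 2)"
      using b cF by (intro mult_mono) auto
    finally show ?thesis by (simp add: mult.commute)
  qed
  show ?thesis
    unfolding bounded_hypergraph_def
  proof (intro conjI allI ballI impI)
    show "finite (K_edges n \<times> {1..k})" by (simp add: finite_K_edges)
    show "finite (order_embeddings N n \<times> F)" by (simp add: finite_order_embeddings finF)
    fix p assume p: "p \<in> order_embeddings N n \<times> F"
    then have emb: "fst p \<in> order_embeddings N n" and col: "snd p \<in> colourings k N"
      using assms by auto
    show "copy_vertices N p \<subseteq> K_edges n \<times> {1..k}"
      using order_embeddings_image_edge[OF emb] col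
      by (auto simp: copy_vertices_def colourings_def)
    have "inj_on (\<lambda>e. (fst p ` e, snd p e)) (K_edges N)"
      using order_embeddings_inj_edges[OF emb] by (auto simp: inj_on_def)
    then show "card (copy_vertices N p) = N choose 2"
      by (simp add: copy_vertices_def card_image card_K_edges)
  next
    fix x :: "nat set \<times> nat"
    show "real (hdeg (copy_vertices N) (order_embeddings N n \<times> F) x) \<le> D"
    proof (cases "card (fst x) = 2")
      case True
      then have "finite (fst x)" using card_eq_0_iff by fastforce
      then have "card {\<phi> \<in> order_embeddings N n. fst x \<subseteq> \<phi> ` {1..N}} \<le> n ^ (N - 2)"
        using card_embeddings_onto_superset_le[of "fst x" N n] True assms by simp
      then have "real (card {\<phi> \<in> order_embeddings N n. fst x \<subseteq> \<phi> ` {1..N}}) \<le> real n ^ (N - 2)"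
        by (metis of_nat_le_iff of_nat_power)
      moreover have "{p \<in> order_embeddings N n \<times> F. x \<in> copy_vertices N p}
          \<subseteq> {\<phi> \<in> order_embeddings N n. fst x \<subseteq> \<phi> ` {1..N}} \<times> F"
      proof
        fix p assume "p \<in> {p \<in> order_embeddings N n \<times> F. x \<in> copy_vertices N p}"
        then show "p \<in> {\<phi> \<in> order_embeddings N n. fst x \<subseteq> \<phi> ` {1..N}} \<times> F"
          using sub(1)[of "fst p" x "snd p"] by (auto simp: mem_Times_iff)
      qed
      ultimately show ?thesis
        unfolding hdeg_def D_def by (intro bound)
    next
      \<comment> \<open>The bound concerns every \<open>x\<close> of the type; if its first
        component is not a two-element set, it lies in no copy.\<close>
      case False
      then have "{p \<in> order_embeddings N n \<times> F. x \<in> copy_vertices N p} = {}"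
        by (auto dest: sub(2))
      then show ?thesis unfolding hdeg_def by (simp only: card.empty) (simp add: D_def)
    qed
    fix y :: "nat set \<times> nat" assume "x \<noteq> y"
    let ?S = "{p \<in> order_embeddings N n \<times> F. x \<in> copy_vertices N p \<and> y \<in> copy_vertices N p}"
    show "real (card ?S) \<le> D / n"
    proof (cases "?S = {}")
      case True
      then show ?thesis by (simp only: card.empty) (simp add: D_def)
    next
      case False
      then obtain \<phi> c where p: "\<phi> \<in> order_embeddings N n"
        "x \<in> copy_vertices N (\<phi>, c)" "y \<in> copy_vertices N (\<phi>, c)" by auto
      have x2: "card (fst x) = 2" "card (fst y) = 2" using sub(2) p by auto
      then have finxy: "finite (fst x)" "finite (fst y)" using card_eq_0_iff by fastforce+
      \<comment> \<open>Within one copy each edge carries a single colour, so distinct pairs lie on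
        distinct edges.\<close>
      have "fst x \<noteq> fst y"
      proof
        assume eq: "fst x = fst y"
        obtain e e' where "e \<in> K_edges N" "e' \<in> K_edges N" "x = (\<phi> ` e, c e)" "y = (\<phi> ` e', c e')"
          using p(2,3) by (auto simp: copy_vertices_def)
        moreover from this have "e = e'"
          using eq order_embeddings_inj_edges[OF p(1)] by (auto dest: inj_onD)
        ultimately show False using \<open>x \<noteq> y\<close> by simp
      qed
      then have "fst x \<subset> fst x \<union> fst y"
        using x2 finxy by (metis card_subset_eq psubsetI sup.cobounded1 sup.cobounded2)
      then have "2 < card (fst x \<union> fst y)"
        using x2 finxy psubset_card_mono[of "fst x \<union> fst y" "fst x"] by simp
      \<comment> \<open>The union has three or four vertices; fixing three of them gives the
        saving.\<close>
      then obtain Y where Y: "Y \<subseteq> fst x \<union> fst y" "card Y = 3" "finite Y"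
        using obtain_subset_with_card_n[of 3 "fst x \<union> fst y"] by force
      have "Y \<subseteq> \<phi> ` {1..N}" using Y sub(1)[OF p(1,2)] sub(1)[OF p(1,3)] by blast
      then have N3: "3 \<le> N"
        using card_mono[of "\<phi> ` {1..N}" Y] card_image_le[of "{1..N}" \<phi>] Y by simp
      have "card {\<phi> \<in> order_embeddings N n. Y \<subseteq> \<phi> ` {1..N}} \<le> n ^ (N - 3)"
        using card_embeddings_onto_superset_le[of Y N n] Y N3 by simp
      then have "real (card {\<phi> \<in> order_embeddings N n. Y \<subseteq> \<phi> ` {1..N}}) \<le> real n ^ (N - 3)"
        by (metis of_nat_le_iff of_nat_power)
      also have "\<dots> = real n ^ (N - 2) / n"
      proof -
        have "N - 2 = Suc (N - 3)" using N3 by simp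
        then show ?thesis using assms(2) by simp
      qed
      finally have "real (card ?S) \<le> real k ^ (N choose 2) * (real n ^ (N - 2) / n)"
      proof (rule bound[rotated])
        show "?S \<subseteq> {\<phi> \<in> order_embeddings N n. Y \<subseteq> \<phi> ` {1..N}} \<times> F"
        proof
          fix p assume "p \<in> ?S"
          then show "p \<in> {\<phi> \<in> order_embeddings N n. Y \<subseteq> \<phi> ` {1..N}} \<times> F"
            using sub(1)[of "fst p" x "snd p"] sub(1)[of "fst p" y "snd p"] Y(1)
            by (auto simp: mem_Times_iff)
        qed
      qed
      then show ?thesis by (simp add: D_def)
    qed
  qed
qed

section \<open>Templates as independent sets\<close>

lemma realisation_exists:
  assumes "t \<in> templates k n"
  shows "realisations k n t \<noteq> {}"
proof -
  have "\<forall>e\<in>K_edges n. \<exists>a. a \<in> t e \<and> a \<in> {1..k}"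
    using assms by (fastforce simp: templates_def PiE_iff)
  then obtain a where "\<forall>e\<in>K_edges n. a e \<in> t e \<and> a e \<in> {1..k}" by metis
  then have "restrict a (K_edges n) \<in> realisations k n t"
    by (auto simp: realisations_def colourings_def)
  then show ?thesis by blast
qed

text \<open>If the pairs of \<open>t\<close> contained a copy of \<open>c\<close>, then
  \<open>c\<close> transported along \<phi> and completed by any realisation of \<open>t\<close>
  would be a realisation whose restriction lies in \<open>F\<close>.\<close>

lemma template_indep:
  assumes t: "t \<in> templates k n" and forb: "realisations k n t \<subseteq> Forb k N F n"
    and F: "F \<subseteq> colourings k N"
  shows "{(e, a). e \<in> K_edges n \<and> a \<in> t e}
    \<in> indep (K_edges n \<times> {1..k}) (copy_vertices N) (order_embeddings N n \<times> F)"
proof -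
  have tk: "t e \<subseteq> {1..k}" if "e \<in> K_edges n" for e
    using t that by (auto simp: templates_def PiE_iff)
  have "\<not> copy_vertices N (\<phi>, c) \<subseteq> {(e, a). e \<in> K_edges n \<and> a \<in> t e}"
    if \<phi>: "\<phi> \<in> order_embeddings N n" and c: "c \<in> F" for \<phi> c
  proof
    assume sub: "copy_vertices N (\<phi>, c) \<subseteq> {(e, a). e \<in> K_edges n \<and> a \<in> t e}"
    obtain d where d: "d \<in> realisations k n t" using realisation_exists[OF t] by blast
    define pre where "pre = inv_into (K_edges N) ((`) \<phi>)"
    define c' where "c' = (\<lambda>e\<in>K_edges n. if e \<in> (`) \<phi> ` K_edges N then c (pre e) else d e)"
    have pre: "pre (\<phi> ` e) = e" if "e \<in> K_edges N" for e
      unfolding pre_def using order_embeddings_inj_edges[OF \<phi>] that by (rule inv_into_f_f)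
    have c't: "c' e \<in> t e" if e: "e \<in> K_edges n" for e
    proof (cases "e \<in> (`) \<phi> ` K_edges N")
      case True
      then obtain e' where "e' \<in> K_edges N" "e = \<phi> ` e'" by blast
      then show ?thesis using sub e pre by (auto simp: c'_def copy_vertices_def)
    next
      case False
      then show ?thesis using d e by (simp add: c'_def realisations_def)
    qed
    have "c' \<in> colourings k n"
      unfolding colourings_def
    proof (rule PiE_I)
      show "c' e \<in> {1..k}" if "e \<in> K_edges n" for e using c't[OF that] tk[OF that] by blast
    qed (simp add: c'_def)
    then have "c' \<in> realisations k n t" using c't by (simp add: realisations_def)
    then have "restr N c' \<phi> \<notin> F" using forb \<phi> by (auto simp: Forb_def)
    moreover have "restr N c' \<phi> = c"
    proof
      fix e
      \<comment> \<open>Equality as HOL functions also needs agreement off \<open>K_edges N\<close>,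
        where both sides are \<open>undefined\<close>.\<close>
      have "c \<in> extensional (K_edges N)" using c F by (auto simp: colourings_def PiE_def)
      then show "restr N c' \<phi> e = c e"
        using pre order_embeddings_image_edge[OF \<phi>, of e]
        by (auto simp: restr_def c'_def extensional_def)
    qed
    ultimately show False using c by simp
  qed
  then show ?thesis using tk by (auto simp: indep_def)
qed

subsection \<open>Choice of parameters\<close>

text \<open>The logarithm is of order \<open>q * ln n\<close>, with \<open>q\<close> about
  \<open>n powr (2 - 1 / r)\<close>. For \<open>r > 1\<close> the required exponent is smaller than
  \<open>1 / r\<close>, and the gap absorbs \<open>ln n\<close>; for \<open>r = 1\<close> the power
  is \<open>1\<close>.\<close>

lemma log_power_le:
  fixes k r m :: nat
  assumes "2 \<le> k" "1 \<le> r"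
  shows "\<exists>C\<^sub>0>0. \<forall>n q. 2 \<le> n \<longrightarrow> real q \<le> 2 * (k * real n ^ 2 * n powr (- 1 / r)) \<longrightarrow>
    log k ((k * real n ^ 2 + 1) ^ (q * (r - 1) * m)) \<le> C\<^sub>0 / n powr (1 / (2 * real r - 1)) * (n choose 2)"
proof (cases "r = 1")
  case True
  then show ?thesis by (intro exI[of _ 1]) auto
next
  case False
  define \<delta> where "\<delta> = 1 / real r - 1 / (2 * real r - 1)"
  have r2: "r \<ge> 2" using False assms by simp
  then have \<delta>: "\<delta> > 0" by (simp add: \<delta>_def field_simps)
  \<comment> \<open>From \<open>ln (k * n ^ 2 + 1) \<le> ln (k + 1) + 2 * ln n\<close> and
    \<open>ln n \<le> n powr \<delta> / \<delta>\<close>.\<close>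
  define B where "B = ln (real k + 1) + 2 / \<delta>"
  have lnk: "ln (real k) > 0" using assms by simp
  have B: "B > 0" using \<delta> assms by (simp add: B_def add_pos_pos)
  define A where "A = real (r - 1) * m * B / ln k"
  have A: "A \<ge> 0" using B lnk by (simp add: A_def)
  \<comment> \<open>The factor 8 is 2 from the bound on \<open>q\<close> times 4 from
    \<open>n ^ 2 \<le> 4 * (n choose 2)\<close>; the summand 1 keeps \<open>C\<close>
    positive.\<close>
  define C where "C = 8 * real k * A + 1"
  show ?thesis
  proof (intro exI[of _ C] conjI allI impI)
    show "C > 0" using A by (simp add: C_def add_nonneg_pos)
    fix n q :: nat
    assume n: "2 \<le> n" and q: "real q \<le> 2 * (k * real n ^ 2 * n powr (- 1 / r))"
    have n1: "n powr \<delta> \<ge> 1" using n \<delta> by (simp add: ge_one_powr_ge_zero)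
    have "ln (k * real n ^ 2 + 1) \<le> ln ((real k + 1) * real n ^ 2)"
      using n by (subst ln_le_cancel_iff) (auto simp: algebra_simps intro: add_pos_nonneg)
    also have "\<dots> = ln (real k + 1) + 2 * ln n"
      using n by (simp add: ln_mult ln_realpow)
    also have "\<dots> \<le> ln (real k + 1) * n powr \<delta> + 2 * (n powr \<delta> / \<delta>)"
      using n1 n \<delta> ln_powr_bound[of n \<delta>] mult_left_mono[OF n1, of "ln (real k + 1)"]
      by (intro add_mono mult_left_mono) auto
    also have "\<dots> = B * n powr \<delta>" by (simp add: B_def field_simps)
    finally have ln: "ln (k * real n ^ 2 + 1) \<le> B * n powr \<delta>" .
    have n2: "real n ^ 2 \<le> 4 * (n choose 2)"
    proof -
      have "real (n choose 2) = real n * (real n - 1) / 2"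
        using n by (simp add: choose_two real_of_nat_div of_nat_diff)
      moreover have "real n * 2 \<le> real n * n" using n by (intro mult_left_mono) auto
      ultimately show ?thesis by (simp add: power2_eq_square algebra_simps)
    qed
    have "log k ((k * real n ^ 2 + 1) ^ (q * (r - 1) * m))
        = real q * (real (r - 1) * m / ln k * ln (k * real n ^ 2 + 1))"
      by (subst log_nat_power) (auto simp: log_def add_nonneg_pos)
    also have "\<dots> \<le> real q * (real (r - 1) * m / ln k * (B * n powr \<delta>))"
      using ln lnk by (intro mult_left_mono) auto
    also have "\<dots> = real q * (A * n powr \<delta>)" by (simp add: A_def)
    also have "\<dots> \<le> 2 * (k * real n ^ 2 * n powr (- 1 / r)) * (A * n powr \<delta>)"
      using q A by (intro mult_right_mono) auto
    also have "\<dots> = 2 * k * A * real n ^ 2 * (n powr (- 1 / r) * n powr \<delta>)"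
      by (simp add: mult_ac)
    also have "n powr (- 1 / r) * n powr \<delta> = 1 / n powr (1 / (2 * real r - 1))"
      by (simp add: \<delta>_def powr_add[symmetric] powr_minus_divide[symmetric])
    also have "2 * k * A * real n ^ 2 * (1 / n powr (1 / (2 * real r - 1)))
        \<le> 2 * k * A * (4 * (n choose 2)) * (1 / n powr (1 / (2 * real r - 1)))"
      using n2 A by (intro mult_right_mono mult_left_mono) auto
    also have "\<dots> = (8 * real k * A) * ((n choose 2) / n powr (1 / (2 * real r - 1)))"
      by simp
    also have "\<dots> \<le> C * ((n choose 2) / n powr (1 / (2 * real r - 1)))"
      by (intro mult_right_mono) (auto simp: C_def)
    finally show "log k ((k * real n ^ 2 + 1) ^ (q * (r - 1) * m))
        \<le> C / n powr (1 / (2 * real r - 1)) * (n choose 2)" by simp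
  qed
qed

text \<open>Since \<open>q / M \<ge> n powr (- 1 / r)\<close>, its power \<open>r - 1\<close> is at
  least \<open>1 / n\<close>, the ratio of codegree to degree. The ceiling at most doubles
  \<open>q\<close> because \<open>M * n powr (- 1 / r) \<ge> 1\<close>, and the lower bound on
  \<open>n\<close> turns this into \<open>q \<le> \<gamma> * M\<close>.\<close>

lemma copies_container_params:
  fixes k r n :: nat and \<gamma> D :: real
  assumes "1 \<le> k" "1 \<le> r" "1 \<le> n" "(2 / \<gamma>) ^ r \<le> n" "0 < \<gamma>" "0 < D"
  defines "M \<equiv> k * real n ^ 2"
  defines "q \<equiv> nat \<lceil>M * n powr (- 1 / r)\<rceil>"
  shows "container_params r \<gamma> M D (D / n) q" "real q \<le> 2 * (M * n powr (- 1 / r))"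
proof -
  have n: "real n \<ge> 1" using assms by simp
  have Mn: "M \<ge> n" using assms mult_mono[of 1 "real k" "real n" "real n ^ 2"] self_le_power[of "real n" 2]
    by (simp add: M_def)
  have M: "M > 0" using Mn n by linarith
  have "n powr (-1) \<le> n powr (- 1 / r)"
    using n assms by (intro powr_mono) (auto simp: field_simps)
  then have "1 \<le> n * n powr (- 1 / r)" using n by (simp add: powr_minus_divide field_simps)
  also have "\<dots> \<le> M * n powr (- 1 / r)" using Mn by (intro mult_right_mono) auto
  finally have ge1: "1 \<le> M * n powr (- 1 / r)" .
  have q: "M * n powr (- 1 / r) \<le> q" "q \<le> M * n powr (- 1 / r) + 1"
    using ge1 unfolding q_def by linarith+
  then show q2: "real q \<le> 2 * (M * n powr (- 1 / r))" using ge1 by linarith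
  have "2 / \<gamma> = ((2 / \<gamma>) powr r) powr (1 / r)"
    using assms by (simp only: powr_powr) simp
  also have "(2 / \<gamma>) powr r = (2 / \<gamma>) ^ r"
    using assms by (intro powr_realpow) simp
  also have "((2 / \<gamma>) ^ r) powr (1 / r) \<le> n powr (1 / r)" using assms by (intro powr_mono2) auto
  finally have "2 * n powr (- 1 / r) \<le> \<gamma>"
    using assms n by (simp add: powr_minus_divide field_simps)
  then have "M * (2 * n powr (- 1 / r)) \<le> M * \<gamma>" using M by (intro mult_left_mono) auto
  then have q\<gamma>: "q \<le> \<gamma> * M" using q2 by (simp add: mult_ac)
  have "1 / n = n powr (-1)" using n by (simp add: powr_minus_divide)
  also have "\<dots> \<le> n powr (- 1 / r * (r - 1))"
    using n assms by (intro powr_mono) (auto simp: field_simps)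
  also have "\<dots> = (n powr (- 1 / r)) ^ (r - 1)"
    using n by (subst powr_powr[symmetric], subst powr_realpow) auto
  also have "\<dots> \<le> (q / M) ^ (r - 1)"
    using q(1) M by (intro power_mono) (auto simp: field_simps)
  finally have "1 / n * D \<le> (q / M) ^ (r - 1) * D" using assms by (intro mult_right_mono) auto
  moreover have "q > 0" using q(1) ge1 by linarith
  ultimately show "container_params r \<gamma> M D (D / n) q"
    using q\<gamma> M assms by (simp add: container_params_def)
qed

section \<open>From hypergraph containers to templates\<close>

theorem theorem2p6:
  fixes k N :: nat and \<epsilon> :: real
  assumes "\<epsilon> > 0"
  shows "\<exists>(C\<^sub>0::real) (n\<^sub>0::nat). C\<^sub>0 > 0 \<and> n\<^sub>0 > 0 \<and>
    (\<forall>F. F \<subseteq> colourings k N \<and> F \<noteq> {} \<longrightarrow>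
      (\<forall>n\<ge>n\<^sub>0. \<exists>T. T \<subseteq> templates k n \<and>
         container_family k n (Forb k N F n) T \<and>
         (\<forall>t\<in>T. real (card {(\<phi>, c). \<phi> \<in> order_embeddings N n \<and> c \<in> F \<and>
                                c \<in> realisations k N (restr N t \<phi>)})
                  \<le> \<epsilon> * real (n choose N)) \<and>
         log (real k) (real (card T))
           \<le> C\<^sub>0 / (real n powr (1 / (2 * real (N choose 2) - 1))) * real (n choose 2)))"
proof (cases "2 \<le> N \<and> 1 \<le> k")
  case False
  \<comment> \<open>If \<open>N \<le> 1\<close>, then \<open>F\<close> consists of the colouring of
    no edges, to which everything restricts, so \<open>Forb\<close> is empty, while every template
    has a realisation. If \<open>N \<ge> 2\<close> and \<open>k = 0\<close>, there is no colouring
    to form \<open>F\<close>.\<close>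
  have "container_family k n (Forb k N F n) {}"
    if F: "F \<subseteq> colourings k N" "F \<noteq> {}" and n: "n \<ge> 1" for F n
  proof -
    have N: "N \<le> 1"
    proof (rule ccontr)
      assume "\<not> N \<le> 1"
      then have "k = 0" "{1, 2} \<in> K_edges N" using False by (auto simp: K_edges_def)
      then have "colourings k N = {}" unfolding colourings_def by (auto simp: PiE_eq_empty_iff)
      then show False using F by simp
    qed
    then have K: "K_edges N = {}"
      using card_K_edges[of N] finite_K_edges[of N] by (simp add: binomial_eq_0)
    then have "F = {\<lambda>_. undefined}" using F by (auto simp: colourings_def)
    then have "restr N c \<phi> \<in> F" for c \<phi> using K by (auto simp: restr_def)
    moreover have "restrict (\<lambda>i. i) {1..N} \<in> order_embeddings N n"
      using N n by (auto simp: order_embeddings_def mono_on_def inj_on_def)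
    ultimately have "Forb k N F n = {}" by (auto simp: Forb_def)
    then show ?thesis using realisation_exists by (auto simp: container_family_def)
  qed
  then show ?thesis
    \<comment> \<open>For the empty family the logarithm is \<open>0\<close>, because
      \<open>ln 0 = 0\<close>.\<close>
    by (intro exI[of _ 1] conjI allI impI exI[of _ "{}"]) (auto simp: log_def)
next
  case True
  define r where "r = N choose 2"
  have r: "1 \<le> r" using True by (simp add: r_def Suc_le_eq)
  \<comment> \<open>Here \<open>D * M\<close> will be \<open>k ^ r * k * n ^ N\<close>, and
    \<open>n choose N\<close> is at least \<open>(n / N) ^ N\<close>.\<close>
  define \<epsilon>' where "\<epsilon>' = \<epsilon> / (real k ^ r * k * real N ^ N)"
  have "\<epsilon>' > 0" using assms True by (simp add: \<epsilon>'_def)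
  from hypergraph_containers[OF r this, where 'a="nat set \<times> nat" and 'j="(nat \<Rightarrow> nat) \<times> (nat set \<Rightarrow> nat)"]
  obtain \<gamma> m where \<gamma>: "\<gamma> > 0" and containers:
    "\<And>(V::(nat set \<times> nat) set) (J::((nat \<Rightarrow> nat) \<times> (nat set \<Rightarrow> nat)) set) g (M::real) D K q.
      bounded_hypergraph V J g r D K \<Longrightarrow> container_params r \<gamma> M D K q \<Longrightarrow> card V \<le> M \<Longrightarrow>
      coverable (\<lambda>C. C \<subseteq> V \<and> card {j \<in> J. g j \<subseteq> C} \<le> \<epsilon>' * D * M)
        ((card V + 1) ^ (q * (r - 1) * m)) (indep V g J)"
    by blast
  have "\<exists>C\<^sub>0>0. \<forall>n q. 2 \<le> n \<longrightarrow> real q \<le> 2 * (k * real n ^ 2 * n powr (- 1 / r)) \<longrightarrow>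
    log k ((k * real n ^ 2 + 1) ^ (q * (r - 1) * m)) \<le> C\<^sub>0 / n powr (1 / (2 * real r - 1)) * (n choose 2)"
  proof (cases "k = 1")
    case True
    then show ?thesis by (intro exI[of _ 1]) (auto simp: log_def)
  next
    case False
    then show ?thesis using log_power_le[of k r m] r True by simp
  qed
  then obtain C\<^sub>0 where C\<^sub>0: "C\<^sub>0 > 0" and size: "\<And>n q. 2 \<le> n \<Longrightarrow>
      real q \<le> 2 * (k * real n ^ 2 * n powr (- 1 / r)) \<Longrightarrow>
      log k ((k * real n ^ 2 + 1) ^ (q * (r - 1) * m)) \<le> C\<^sub>0 / n powr (1 / (2 * real r - 1)) * (n choose 2)"
    by blast
  \<comment> \<open>\<open>N\<close> serves the binomial bound and the other term the choice of
    \<open>q\<close>. All constants are fixed before \<open>F\<close> is introduced.\<close>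
  define n\<^sub>0 where "n\<^sub>0 = max N (nat \<lceil>(2 / \<gamma>) ^ r\<rceil>)"
  show ?thesis
  proof (intro exI[of _ C\<^sub>0] exI[of _ n\<^sub>0] conjI allI impI)
    show "C\<^sub>0 > 0" by fact
    show "n\<^sub>0 > 0" using True by (simp add: n\<^sub>0_def less_max_iff_disj)
    fix F n
    assume "F \<subseteq> colourings k N \<and> F \<noteq> {}" and "n\<^sub>0 \<le> n"
    then have F: "F \<subseteq> colourings k N" and n: "N \<le> n" "(2 / \<gamma>) ^ r \<le> n" "2 \<le> n"
      using True by (simp_all add: n\<^sub>0_def ceiling_le_iff nat_le_iff)
    define V where "V = K_edges n \<times> {1..k}"
    define J where "J = order_embeddings N n \<times> F"
    define M where "M = k * real n ^ 2"
    define D where "D = real k ^ r * real n ^ (N - 2)"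
    define q where "q = nat \<lceil>M * n powr (- 1 / r)\<rceil>"
    have D: "D > 0" using True n by (simp add: D_def)
    have bh: "bounded_hypergraph V J (copy_vertices N) r D (D / n)"
      unfolding V_def J_def D_def r_def using True n F by (intro bounded_hypergraph_copies) auto
    have cp: "container_params r \<gamma> M D (D / n) q" and q: "real q \<le> 2 * (M * n powr (- 1 / r))"
      unfolding M_def q_def using copies_container_params[of k r n \<gamma> D] True r n \<gamma> D by auto
    have "n choose 2 \<le> n ^ 2" using n by (intro binomial_le_pow)
    then have "card V \<le> k * n ^ 2"
      by (simp add: V_def card_cartesian_product card_K_edges mult.commute)
    then have VM: "card V \<le> M" unfolding M_def by (metis of_nat_le_iff of_nat_mult of_nat_power)
    from containers[OF bh cp VM] obtain \<C> where \<C>: "finite \<C>" "card \<C> \<le> (card V + 1) ^ (q * (r - 1) * m)"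
      "\<And>C. C \<in> \<C> \<Longrightarrow> C \<subseteq> V \<and> card {j \<in> J. copy_vertices N j \<subseteq> C} \<le> \<epsilon>' * D * M"
      "\<And>I. I \<in> indep V (copy_vertices N) J \<Longrightarrow> \<exists>C\<in>\<C>. I \<subseteq> C"
      by (rule coverableE) blast
    define tmpl :: "(nat set \<times> nat) set \<Rightarrow> nat set \<Rightarrow> nat set"
      where "tmpl C = (\<lambda>e\<in>K_edges n. {a. (e, a) \<in> C})" for C
    have few: "\<epsilon>' * D * M \<le> \<epsilon> * (n choose N)"
    proof -
      have nN: "real n ^ (N - 2) * real n ^ 2 = real n ^ N"
        using True by (metis le_add_diff_inverse2 power_add)
      have "\<epsilon>' * D * M =
          \<epsilon> / (real k ^ r * k * real N ^ N) * (real k ^ r * k) * (real n ^ (N - 2) * real n ^ 2)"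
        by (simp add: \<epsilon>'_def D_def M_def)
      also have "\<dots> = \<epsilon> * (real n / real N) ^ N"
        using True unfolding nN by (simp add: power_divide)
      also have "\<dots> \<le> \<epsilon> * (n choose N)"
        using assms n binomial_ge_n_over_k_pow_k[of N n, where 'a=real] by (intro mult_left_mono) auto
      finally show ?thesis .
    qed
    show "\<exists>T. T \<subseteq> templates k n \<and>
         container_family k n (Forb k N F n) T \<and>
         (\<forall>t\<in>T. real (card {(\<phi>, c). \<phi> \<in> order_embeddings N n \<and> c \<in> F \<and>
                                c \<in> realisations k N (restr N t \<phi>)})
                  \<le> \<epsilon> * real (n choose N)) \<and>
         log (real k) (real (card T))
           \<le> C\<^sub>0 / (real n powr (1 / (2 * real (N choose 2) - 1))) * real (n choose 2)"
    \<comment> \<open>A container may leave some edge without colours; intersecting with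
      \<open>templates k n\<close> discards it. A container covering the pairs of a template
      survives, since that template has a colour at every edge.\<close>
    proof (intro exI[of _ "templates k n \<inter> tmpl ` \<C>"] conjI ballI)
      show "container_family k n (Forb k N F n) (templates k n \<inter> tmpl ` \<C>)"
        unfolding container_family_def
      proof (intro ballI impI)
        fix t assume t: "t \<in> templates k n" and forb: "realisations k n t \<subseteq> Forb k N F n"
        from \<C>(4)[OF template_indep[OF t forb F, folded V_def J_def]]
        obtain C where C: "C \<in> \<C>" "{(e, a). e \<in> K_edges n \<and> a \<in> t e} \<subseteq> C" by blast
        then have sub: "t e \<subseteq> tmpl C e" if "e \<in> K_edges n" for e
          using that by (auto simp: tmpl_def)
        have CV: "C \<subseteq> V" using \<C>(3)[OF C(1)] by simp
        have "tmpl C \<in> templates k n"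
          unfolding templates_def
        proof (rule PiE_I)
          fix e assume e: "e \<in> K_edges n"
          have "t e \<noteq> {}" using t e by (auto simp: templates_def PiE_iff)
          moreover have "tmpl C e \<subseteq> {1..k}" using CV e by (auto simp: tmpl_def V_def)
          ultimately show "tmpl C e \<in> Pow {1..k} - {{}}" using sub[OF e] by blast
        qed (simp add: tmpl_def)
        then show "\<exists>t'\<in>templates k n \<inter> tmpl ` \<C>. \<forall>e\<in>K_edges n. t e \<subseteq> t' e"
          using C(1) sub by blast
      qed
    next
      fix t assume "t \<in> templates k n \<inter> tmpl ` \<C>"
      then obtain C where C: "C \<in> \<C>" "t = tmpl C" by blast
      \<comment> \<open>If \<open>c\<close> realises the restriction of \<open>t\<close>, every pair
        of the copy belongs to \<open>C\<close>, so the copy is a hyperedge inside the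
        container.\<close>
      have "{(\<phi>, c). \<phi> \<in> order_embeddings N n \<and> c \<in> F \<and> c \<in> realisations k N (restr N t \<phi>)}
          \<subseteq> {j \<in> J. copy_vertices N j \<subseteq> C}"
        using order_embeddings_image_edge
        by (auto simp: J_def copy_vertices_def realisations_def restr_def C(2) tmpl_def)
      moreover have "finite {j \<in> J. copy_vertices N j \<subseteq> C}"
        using bh by (simp add: bounded_hypergraph_def)
      ultimately have "card {(\<phi>, c). \<phi> \<in> order_embeddings N n \<and> c \<in> F \<and> c \<in> realisations k N (restr N t \<phi>)}
          \<le> card {j \<in> J. copy_vertices N j \<subseteq> C}" by (intro card_mono)
      then show "real (card {(\<phi>, c). \<phi> \<in> order_embeddings N n \<and> c \<in> F \<and> c \<in> realisations k N (restr N t \<phi>)})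
          \<le> \<epsilon> * real (n choose N)"
        using \<C>(3)[OF C(1)] few by linarith
    next
      let ?T = "templates k n \<inter> tmpl ` \<C>"
      show "log (real k) (real (card ?T))
           \<le> C\<^sub>0 / (real n powr (1 / (2 * real (N choose 2) - 1))) * real (n choose 2)"
      \<comment> \<open>In both degenerate cases the logarithm takes the junk value \<open>0\<close>.\<close>
      proof (cases "card ?T = 0 \<or> k = 1")
        case True
        then have "log (real k) (real (card ?T)) = 0" by (auto simp: log_def)
        then show ?thesis using C\<^sub>0 by simp
      next
        case False
        have "card ?T \<le> card (tmpl ` \<C>)" using \<C>(1) by (intro card_mono) auto
        also have "\<dots> \<le> card \<C>" using \<C>(1) by (rule card_image_le)
        finally have "card ?T \<le> (card V + 1) ^ (q * (r - 1) * m)" using \<C>(2) by linarith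
        then have "real (card ?T) \<le> (real (card V) + 1) ^ (q * (r - 1) * m)"
          by (metis of_nat_1 of_nat_add of_nat_le_iff of_nat_power)
        also have "\<dots> \<le> (M + 1) ^ (q * (r - 1) * m)"
          using VM by (intro power_mono) auto
        finally have "log k (card ?T) \<le> log k ((M + 1) ^ (q * (r - 1) * m))"
          using False True by (intro log_mono) auto
        also have "\<dots> \<le> C\<^sub>0 / n powr (1 / (2 * real r - 1)) * (n choose 2)"
          using size[of n q] n q by (simp add: M_def)
        finally show ?thesis by (simp add: r_def)
      qed
    qed simp
  qed
qed

end
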